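(* Let $n \geq 2$ be an integer. Two vertices in the Full-Flag Johnson graph $FJ(n,1)$ are adjacent if and only if they are related by a neighboring transposition.
   Context: For a permutation $u=(u_1,\ldots,u_n)$ of $(1,2,\ldots,n)$ and $i \in [n]=\{1,\ldots,n\}$ write $u(i) = \{u_1, u_2, \ldots, u_i\}$. For integers $0 \leq k < n$, the Full-Flag Johnson graph $FJ(n,k)$ has as vertex set all permutations of $(1,\ldots,n)$; two vertices $u,v$ are adjacent if and only if $u(i) \neq v(i)$ for exactly $k$ integers $i \in [n]$. Two permutations $u$ and $v$ are related by a neighboring transposition if there is $i \in [n-1]$ such that $v = (u_1,\ldots,u_{i-1},u_{i+1},u_i,u_{i+2},\ldots,u_n)$, i.e. $v$ is obtained from $u$ by interchanging the entries in positions $i$ and $i+1$. *)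

theory Defs
  imports "HOL-Combinatorics.Permutations" "Graph_Theory.Pair_Digraph"
begin

text \<open>
  A permutation \<open>(u\<^sub>1, \<dots>, u\<^sub>n)\<close> of \<open>(1, \<dots>, n)\<close> is a function \<open>u\<close> with \<open>u permutes {1..n}\<close>, where
  \<open>u j\<close> is the entry in position \<open>j\<close>. Outside \<open>{1..n}\<close> such a function is the identity, so
  equality of functions is equality of the words.
\<close>

definition prefix_set :: "(nat \<Rightarrow> nat) \<Rightarrow> nat \<Rightarrow> nat set" where
  "prefix_set u i = u ` {1..i}"

text \<open>
  An undirected graph is represented by its symmetric arc relation. The intended parameter range
  is \<open>k < n\<close>. For \<open>k = 0\<close> every vertex carries a loop.
\<close>

definition FJ :: "nat \<Rightarrow> nat \<Rightarrow> (nat \<Rightarrow> nat) pair_pre_digraph" where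
  "FJ n k = \<lparr> pverts = {u. u permutes {1..n}},
     parcs = {(u, v). u permutes {1..n} \<and> v permutes {1..n} \<and>
       card {i \<in> {1..n}. prefix_set u i \<noteq> prefix_set v i} = k} \<rparr>"

definition neighboring_transposition :: "nat \<Rightarrow> (nat \<Rightarrow> nat) \<Rightarrow> (nat \<Rightarrow> nat) \<Rightarrow> bool" where
  "neighboring_transposition n u v \<longleftrightarrow> (\<exists>i\<in>{1..n - 1}. v = u(i := u (i + 1), i + 1 := u i))"

lemma pair_pseudo_graph_FJ: "pair_pseudo_graph (FJ n k)"
proof
  show fin: "finite (pverts (FJ n k))"
    by (simp add: FJ_def finite_permutations)
  have "parcs (FJ n k) \<subseteq> pverts (FJ n k) \<times> pverts (FJ n k)"
    by (auto simp: FJ_def)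
  then show "finite (parcs (FJ n k))"
    using fin by (meson finite_SigmaI finite_subset)
  have "sym (parcs (FJ n k))"
  proof (rule symI)
    fix u v assume uv: "(u, v) \<in> parcs (FJ n k)"
    have "{i \<in> {1..n}. prefix_set v i \<noteq> prefix_set u i} =
          {i \<in> {1..n}. prefix_set u i \<noteq> prefix_set v i}"
      by blast
    then have "card {i \<in> {1..n}. prefix_set v i \<noteq> prefix_set u i} =
               card {i \<in> {1..n}. prefix_set u i \<noteq> prefix_set v i}"
      by (rule arg_cong)
    also have "\<dots> = k"
      using uv by (simp add: FJ_def)
    finally show "(v, u) \<in> parcs (FJ n k)"
      using uv by (simp add: FJ_def)
  qed
  then show "symmetric (FJ n k)"
    by (simp add: symmetric_def)
qed (auto simp: FJ_def)

end

theory Submission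
  imports Defs
begin

text \<open>
  A word is determined by its chain of prefix sets: the entry in position \<open>i + 1\<close> is what prefix
  set \<open>i + 1\<close> adds to prefix set \<open>i\<close>. If two chains differ at \<open>i\<close> only, the words agree in all
  positions except \<open>i\<close> and \<open>i + 1\<close>, where they contain the same two entries in different order.
\<close>

lemma prefix_set_0 [simp]: "prefix_set u 0 = {}"
  by (simp add: prefix_set_def)

lemma prefix_set_Suc: "prefix_set u (Suc i) = insert (u (Suc i)) (prefix_set u i)"
  by (simp add: prefix_set_def atLeastAtMostSuc_conv)

lemma entry_mem_prefix_set_iff:
  assumes "inj u"
  shows "u j \<in> prefix_set u i \<longleftrightarrow> 1 \<le> j \<and> j \<le> i"
  using assms by (simp add: prefix_set_def inj_image_mem_iff)

lemma prefix_set_full: "u permutes {1..n} \<Longrightarrow> prefix_set u n = {1..n}"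
  unfolding prefix_set_def by (rule permutes_image)

text \<open>By injectivity \<open>u (Suc i)\<close> is new at stage \<open>Suc i\<close>, and the
  set difference, written with \<open>v\<close>, contains at most \<open>v (Suc i)\<close>.\<close>

lemma prefix_sets_eq_imp_entry_eq:
  assumes "inj u"
    and "prefix_set u i = prefix_set v i" and "prefix_set u (Suc i) = prefix_set v (Suc i)"
  shows "u (Suc i) = v (Suc i)"
proof -
  have "u (Suc i) \<in> prefix_set v (Suc i) - prefix_set v i"
    unfolding assms(2,3)[symmetric] by (simp add: entry_mem_prefix_set_iff[OF \<open>inj u\<close>])
  then show ?thesis
    by (auto simp: prefix_set_Suc)
qed

text \<open>The entry \<open>v (Suc i)\<close> enters between the two common prefix sets, so it is
  one of the two entries that \<open>u\<close> adds there. If it were \<open>u (Suc i)\<close>, the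
  middle prefix sets would coincide.\<close>

lemma prefix_sets_eq_except_one:
  assumes "inj u" and "inj v"
    and "prefix_set u i = prefix_set v i" and "prefix_set u (Suc i) \<noteq> prefix_set v (Suc i)"
    and "prefix_set u (Suc (Suc i)) = prefix_set v (Suc (Suc i))"
  shows "v (Suc i) = u (Suc (Suc i))"
proof -
  have "v (Suc i) \<in> prefix_set u (Suc (Suc i))"
    unfolding assms(5) by (simp add: prefix_set_Suc)
  moreover have "v (Suc i) \<notin> prefix_set u i"
    unfolding assms(3) by (simp add: entry_mem_prefix_set_iff[OF \<open>inj v\<close>])
  moreover have "v (Suc i) \<noteq> u (Suc i)"
    using assms(3,4) by (auto simp: prefix_set_Suc)
  ultimately show ?thesis
    by (simp add: prefix_set_Suc)
qed

text \<open>A prefix shorter than \<open>i\<close> avoids both exchanged positions. A prefix longer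
  than \<open>i\<close> contains both, so the exchange only permutes its positions.\<close>

lemma prefix_set_swap:
  assumes "1 \<le> i" and "j \<noteq> i"
  shows "prefix_set (u(i := u (i + 1), i + 1 := u i)) j = prefix_set u j"
proof (cases "j < i")
  case True
  then show ?thesis
    unfolding prefix_set_def by (intro image_cong) auto
next
  case False
  have swap: "u(i := u (i + 1), i + 1 := u i) = u \<circ> Transposition.transpose i (i + 1)"
    by (auto simp: fun_eq_iff Transposition.transpose_def)
  have "Transposition.transpose i (i + 1) permutes {1..j}"
    using False assms by (intro permutes_swap_id) auto
  then have "Transposition.transpose i (i + 1) ` {1..j} = {1..j}"
    by (rule permutes_image)
  then show ?thesis
    unfolding prefix_set_def swap by (metis image_comp)
qed

text \<open>The exchange brings \<open>u (i + 1)\<close> into the first \<open>i\<close> positions,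
  where injectivity of \<open>u\<close> excludes it before.\<close>

lemma prefix_set_swap_neq:
  assumes "inj u" and "1 \<le> i"
  shows "prefix_set (u(i := u (i + 1), i + 1 := u i)) i \<noteq> prefix_set u i"
proof -
  have "u (i + 1) \<in> prefix_set (u(i := u (i + 1), i + 1 := u i)) i"
    using \<open>1 \<le> i\<close> by (force simp: prefix_set_def)
  moreover have "u (i + 1) \<notin> prefix_set u i"
    by (simp add: entry_mem_prefix_set_iff[OF \<open>inj u\<close>])
  ultimately show ?thesis
    by blast
qed

theorem lemma2p4:
  fixes n :: nat and u v :: "nat \<Rightarrow> nat"
  assumes "n \<ge> 2"
    and "u \<in> pverts (FJ n 1)" and "v \<in> pverts (FJ n 1)"
  shows "(u, v) \<in> parcs (FJ n 1) \<longleftrightarrow> neighboring_transposition n u v"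
proof -
  let ?D = "{i \<in> {1..n}. prefix_set u i \<noteq> prefix_set v i}"
  have u: "u permutes {1..n}" and v: "v permutes {1..n}"
    using assms(2,3) by (simp_all add: FJ_def)
  then have inj: "inj u" "inj v"
    by (simp_all add: permutes_inj)
  have "(u, v) \<in> parcs (FJ n 1) \<longleftrightarrow> (\<exists>i. ?D = {i})"
    using u v by (simp add: FJ_def card_1_singleton_iff)
  also have "\<dots> \<longleftrightarrow> neighboring_transposition n u v"
  proof
    assume "\<exists>i. ?D = {i}"
    then obtain i where D: "?D = {i}" ..
    have "i \<in> ?D"
      unfolding D by simp
    then have i: "1 \<le> i" "i \<le> n" and neq: "prefix_set u i \<noteq> prefix_set v i"
      by simp_all
    \<comment> \<open>The full prefix sets are both \<open>{1..n}\<close>; hence position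
      \<open>i + 1\<close> still lies inside the word.\<close>
    have "i \<noteq> n"
      using neq prefix_set_full[OF u] prefix_set_full[OF v] by auto
    with i have "i < n"
      by simp
    \<comment> \<open>Index 0 lies outside the range of \<open>?D\<close> but is included here: when
      \<open>i = 1\<close>, the prefix set below \<open>i\<close> is the empty one.\<close>
    have eq: "prefix_set u j = prefix_set v j" if "j \<le> n" "j \<noteq> i" for j
    proof (cases "j = 0")
      case False
      have "j \<notin> ?D"
        unfolding D using \<open>j \<noteq> i\<close> by simp
      with False \<open>j \<le> n\<close> show ?thesis
        by simp
    qed simp
    obtain k where k: "i = Suc k"
      using i by (cases i) auto
    have around: "prefix_set u k = prefix_set v k"
        "prefix_set u (Suc (Suc k)) = prefix_set v (Suc (Suc k))"
      using \<open>i < n\<close> k by (simp_all add: eq)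
    have "v i = u (i + 1)"
      using prefix_sets_eq_except_one[OF inj] around neq k by simp
    \<comment> \<open>The same lemma with \<open>u\<close> and \<open>v\<close> exchanged.\<close>
    moreover have "v (i + 1) = u i"
      using prefix_sets_eq_except_one[OF inj(2,1)] around neq k by simp
    moreover have "v j = u j" if "j \<noteq> i" "j \<noteq> i + 1" for j
    proof (cases "j \<in> {1..n}")
      case True
      then obtain l where l: "j = Suc l"
        by (cases j) auto
      then show ?thesis
        \<comment> \<open>The two conditions on \<open>j\<close> say exactly that neither
          \<open>Suc l\<close> nor \<open>l\<close> equals \<open>i\<close>, so both prefix sets
          around position \<open>j\<close> agree.\<close>
        using prefix_sets_eq_imp_entry_eq[OF inj(1) eq eq, of l] that True by simp
    next
      case False
      then show ?thesis
        using permutes_not_in[OF u] permutes_not_in[OF v] by simp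
    qed
    ultimately have "v = u(i := u (i + 1), i + 1 := u i)"
      by (intro ext) simp
    then show "neighboring_transposition n u v"
      unfolding neighboring_transposition_def using i \<open>i < n\<close> by (intro bexI[of _ i]) auto
  next
    assume "neighboring_transposition n u v"
    then obtain i where i: "1 \<le> i" "i \<le> n - 1" and v_eq: "v = u(i := u (i + 1), i + 1 := u i)"
      by (auto simp: neighboring_transposition_def)
    have "prefix_set v j = prefix_set u j" if "j \<noteq> i" for j
      unfolding v_eq using i(1) that by (rule prefix_set_swap)
    then have "?D \<subseteq> {i}"
      by blast
    moreover have "prefix_set v i \<noteq> prefix_set u i"
      unfolding v_eq using inj(1) i(1) by (rule prefix_set_swap_neq)
    then have "i \<in> ?D"
      using i by simp
    ultimately have "?D = {i}"
      by blast
    then show "\<exists>i. ?D = {i}" ..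
  qed
  finally show ?thesis .
qed

end
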